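(* Let $p\ge 2$, let $m<M$ be reals, $Z=(m,M)^p$, $\hat Z=[m,M]^p$. Let $N\subset Z$ be a finite and stable set and let $\bar z\in Z$ be a point not dominated by any point of $N$. Let $\hat N=N\cup\{\hat z^1,\dots,\hat z^p\}$ with $\hat z^j$ having $j$th component $M$ and all other components $m$. For $u\in U(N)$ and $k\in\{1,\dots,p\}$ let $Z^k(u)=\{z\in\hat N: z_k=u_k \text{ and } z_{-k}<u_{-k}\}$. Consider $u\in U(N)$ with $\bar z<u$, and for $j\in\{1,\dots,p\}$ let $z^{\max}_j(u)=\max_{k\neq j}\min\{z_j: z\in Z^k(u)\}$. Then for every $j\in\{1,\dots,p\}$, the point $(\bar z_j,u_{-j})$ belongs to $U(N\cup\{\bar z\})$ if and only if $\bar z_j>z^{\max}_j(u)$.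
   Context: For $z^1,z^2\in\mathbb{R}^p$: $z^1\leqq z^2$ means $z^1_j\le z^2_j$ for all $j$; $z^1\leq z^2$ ($z^1$ dominates $z^2$) means $z^1\leqq z^2$ and $z^1\neq z^2$; $z^1<z^2$ means $z^1_j<z^2_j$ for all $j$. A set $N\subset Z$ is stable if $z^1\not\leq z^2$ for all $z^1,z^2\in N$. $z_{-j}$ denotes the $(p-1)$-vector of components of $z$ other than $j$, and $(z_j,a_{-j})$ denotes $(a_1,\dots,a_{j-1},z_j,a_{j+1},\dots,a_p)$. For a finite set $Q\subset Z$, the search region is $S(Q)=\{z\in Z:\ \bar z\not\leqq z \text{ for all } \bar z\in Q\}$; for $u\in\hat Z$, $C(u)=\{z\in Z: z<u\}$. The upper bound set $U(Q)\subset\hat Z$ is the (unique) set satisfying (1) $S(Q)=\bigcup_{u\in U(Q)}C(u)$ and (2) for all $u^1,u^2\in U(Q)$, $C(u^1)$ is not a proper subset of $C(u^2)$. For $u\in U(N)$ each set $Z^k(u)$ is non-empty. *)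

theory Defs
  imports "HOL-Analysis.Analysis"
begin

text \<open>
  The library order \<open>\<le>\<close> on \<^typ>\<open>real ^ 'p\<close> is the componentwise weak order, but the library \<open><\<close>
  is \<^emph>\<open>not\<close> the componentwise strict order: it coincides with \<open>dominates\<close> below.
\<close>

definition dominates :: "real ^ 'p \<Rightarrow> real ^ 'p \<Rightarrow> bool" where
  "dominates z1 z2 \<longleftrightarrow> z1 \<le> z2 \<and> z1 \<noteq> z2"

definition strictly_below :: "real ^ 'p \<Rightarrow> real ^ 'p \<Rightarrow> bool" where
  "strictly_below z1 z2 \<longleftrightarrow> (\<forall>j. z1 $ j < z2 $ j)"

definition stable_set :: "(real ^ 'p) set \<Rightarrow> bool" where
  "stable_set N \<longleftrightarrow> (\<forall>z1\<in>N. \<forall>z2\<in>N. \<not> dominates z1 z2)"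

definition open_cube :: "real \<Rightarrow> real \<Rightarrow> (real ^ 'p) set" where
  "open_cube m M = {z. \<forall>j. z $ j \<in> {m<..<M}}"

definition closed_cube :: "real \<Rightarrow> real \<Rightarrow> (real ^ 'p) set" where
  "closed_cube m M = {z. \<forall>j. z $ j \<in> {m..M}}"

definition search_region :: "real \<Rightarrow> real \<Rightarrow> (real ^ 'p) set \<Rightarrow> (real ^ 'p) set" where
  "search_region m M Q = {z \<in> open_cube m M. \<forall>zb\<in>Q. \<not> zb \<le> z}"

definition search_zone :: "real \<Rightarrow> real \<Rightarrow> real ^ 'p \<Rightarrow> (real ^ 'p) set" where
  "search_zone m M u = {z \<in> open_cube m M. strictly_below z u}"

definition is_upper_bound_set ::
    "real \<Rightarrow> real \<Rightarrow> (real ^ 'p) set \<Rightarrow> (real ^ 'p) set \<Rightarrow> bool" where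
  "is_upper_bound_set m M Q U \<longleftrightarrow>
     U \<subseteq> closed_cube m M \<and>
     search_region m M Q = (\<Union>u\<in>U. search_zone m M u) \<and>
     (\<forall>u1\<in>U. \<forall>u2\<in>U. \<not> search_zone m M u1 \<subset> search_zone m M u2)"

text \<open>
  For \<open>m < M\<close> and finite \<open>Q \<subseteq> open_cube m M\<close> such a set exists and is unique: it consists of
  the maximal \<open>u\<close> in the closed cube with no point of \<open>Q\<close> strictly below \<open>u\<close>.
\<close>

definition upper_bound_set :: "real \<Rightarrow> real \<Rightarrow> (real ^ 'p) set \<Rightarrow> (real ^ 'p) set" where
  "upper_bound_set m M Q = (THE U. is_upper_bound_set m M Q U)"

definition dummy_point :: "real \<Rightarrow> real \<Rightarrow> 'p \<Rightarrow> real ^ 'p" where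
  "dummy_point m M j = (\<chi> i. if i = j then M else m)"

definition augmented :: "real \<Rightarrow> real \<Rightarrow> (real ^ 'p) set \<Rightarrow> (real ^ 'p) set" where
  "augmented m M N = N \<union> range (dummy_point m M)"

definition defining_points ::
    "real \<Rightarrow> real \<Rightarrow> (real ^ 'p) set \<Rightarrow> 'p \<Rightarrow> real ^ 'p \<Rightarrow> (real ^ 'p) set" where
  "defining_points m M N k u =
     {z \<in> augmented m M N. z $ k = u $ k \<and> (\<forall>i. i \<noteq> k \<longrightarrow> z $ i < u $ i)}"

text \<open>
  \<open>Min\<close> and \<open>Max\<close> are meaningful here when \<open>N\<close> is finite, \<open>u\<close> is in the upper bound set of \<open>N\<close>
  (all \<open>defining_points m M N k u\<close> are then nonempty) and the dimension is at least 2.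
\<close>

definition z_max :: "real \<Rightarrow> real \<Rightarrow> (real ^ 'p) set \<Rightarrow> 'p \<Rightarrow> real ^ 'p \<Rightarrow> real" where
  "z_max m M N j u = (MAX k\<in>UNIV - {j}. MIN z\<in>defining_points m M N k u. z $ j)"

definition replace_component :: "'p \<Rightarrow> real \<Rightarrow> real ^ 'p \<Rightarrow> real ^ 'p" where
  "replace_component j x a = (\<chi> i. if i = j then x else a $ i)"

end

theory Submission imports Defs begin

text \<open>
  For a finite set \<open>Q\<close> in the open cube, the upper bound set is the set of maximal elements of the
  family of points \<open>u\<close> of the closed cube that have no point of \<open>Q\<close> strictly below them. A member
  \<open>u\<close> of this family is maximal iff every coordinate \<open>k\<close> is blocked, i.e. has a defining point.
  After replacing \<open>u $ j\<close> by \<open>zb $ j\<close>, coordinate \<open>j\<close> is blocked by \<open>zb\<close>, while another coordinate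
  \<open>k\<close> is blocked precisely by those old defining points \<open>z\<close> with \<open>z $ j < zb $ j\<close>.
\<close>

section \<open>Candidate bounds, gaps between coordinate values, inclusion of zones\<close>

text \<open>For \<open>Q\<close> inside the open cube these are exactly the points of the closed
  cube whose search zone lies in the search region of \<open>Q\<close>.\<close>

definition unblocked :: "real \<Rightarrow> real \<Rightarrow> (real ^ 'p) set \<Rightarrow> (real ^ 'p) set" where
  "unblocked m M Q = {u \<in> closed_cube m M. \<forall>q\<in>Q. \<not> strictly_below q u}"

definition maximal_unblocked :: "real \<Rightarrow> real \<Rightarrow> (real ^ 'p) set \<Rightarrow> (real ^ 'p) set" where
  "maximal_unblocked m M Q = {u \<in> unblocked m M Q. \<forall>v\<in>unblocked m M Q. u \<le> v \<longrightarrow> v = u}"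

lemma finite_gap_above:
  fixes x b :: real
  assumes "finite A" and "x < b"
  obtains y where "x < y" "y \<le> b" "\<And>a. a \<in> A \<Longrightarrow> a < y \<Longrightarrow> a \<le> x"
proof
  let ?B = "insert b {a\<in>A. x < a}"
  have fin: "finite ?B" using assms by simp
  show "x < Min ?B" using fin assms by (subst Min_gr_iff) auto
  show "Min ?B \<le> b" using fin by (intro Min_le) auto
  show "a \<le> x" if "a \<in> A" "a < Min ?B" for a
    using that fin Min_le[of ?B a] by fastforce
qed

lemma finite_gap_below:
  fixes x b :: real
  assumes "finite A" and "b < x"
  obtains y where "b < y" "y < x" "\<And>a. a \<in> A \<Longrightarrow> a < x \<Longrightarrow> a \<le> y"
proof
  let ?B = "insert ((b + x) / 2) {a\<in>A. a < x}"
  have fin: "finite ?B" using assms by simp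
  have "(b + x) / 2 \<le> Max ?B" using fin by (intro Max_ge) auto
  then show "b < Max ?B" using assms by simp
  show "Max ?B < x" using fin assms by (subst Max_less_iff) auto
  show "a \<le> Max ?B" if "a \<in> A" "a < x" for a
    using that fin by (intro Max_ge) auto
qed

lemma search_zone_subset_region:
  assumes "u \<in> unblocked m M Q"
  shows "search_zone m M u \<subseteq> search_region m M Q"
proof
  fix z assume z: "z \<in> search_zone m M u"
  have "\<not> q \<le> z" if "q \<in> Q" for q
  proof
    assume "q \<le> z"
    then have "strictly_below q u"
      using z unfolding search_zone_def strictly_below_def less_eq_vec_def
      by (auto intro: le_less_trans)
    then show False using assms that unfolding unblocked_def by blast
  qed
  then show "z \<in> search_region m M Q"
    using z unfolding search_zone_def search_region_def by blast
qed

lemma unblocked_if_zone_subset_region: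
  assumes "Q \<subseteq> open_cube m M" and "u \<in> closed_cube m M"
    and "search_zone m M u \<subseteq> search_region m M Q"
  shows "u \<in> unblocked m M Q"
proof -
  have "\<not> strictly_below q u" if "q \<in> Q" for q
  proof
    assume "strictly_below q u"
    then have "q \<in> search_region m M Q"
      using assms(1,3) that by (auto simp: search_zone_def)
    then show False using that by (auto simp: search_region_def)
  qed
  then show ?thesis using assms(2) by (simp add: unblocked_def)
qed

lemma search_zone_psubset:
  assumes w: "w \<in> closed_cube m M" "\<And>i. m < w $ i" and "v \<le> w" "v \<noteq> w"
  shows "search_zone m M v \<subset> search_zone m M w"
proof
  have le: "v $ i \<le> w $ i" for i using \<open>v \<le> w\<close> by (simp add: less_eq_vec_def)
  show "search_zone m M v \<subseteq> search_zone m M w"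
    unfolding search_zone_def strictly_below_def using le by (auto intro: less_le_trans)
  obtain i where "v $ i \<noteq> w $ i" using \<open>v \<noteq> w\<close> by (auto simp: vec_eq_iff)
  with le[of i] have i: "v $ i < w $ i" by simp
  \<comment> \<open>The entry at \<open>i\<close> is at least \<open>v $ i\<close>, so
    \<open>z\<close> leaves the zone of \<open>v\<close>; since \<open>v\<close> may lie outside the
    cube, the maximum with a midpoint keeps that entry above \<open>m\<close>.\<close>
  define z where "z = (\<chi> k. if k = i then max (v $ i) ((m + w $ i) / 2) else (m + w $ k) / 2)"
  have z: "m < z $ k" "z $ k < w $ k" for k
    using w(2)[of k] i by (auto simp: z_def max_def)
  have "w $ k \<le> M" for k using w(1) by (auto simp: closed_cube_def)
  with z have "z \<in> search_zone m M w"
    unfolding search_zone_def open_cube_def strictly_below_def by (auto intro: less_le_trans)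
  moreover have "z \<notin> search_zone m M v"
    unfolding search_zone_def strictly_below_def by (auto simp: z_def intro!: exI[of _ i])
  ultimately show "search_zone m M v \<noteq> search_zone m M w" by blast
qed

text \<open>The raise is too small to pass any new value \<open>q $ k\<close>, so a point of
  \<open>Q\<close> strictly below \<open>v\<close> but not strictly below \<open>u\<close> must tie
  with \<open>u\<close> in coordinate \<open>k\<close>.\<close>

lemma unblocked_raise_component:
  fixes u :: "real ^ 'p"
  assumes "finite Q" and u: "u \<in> unblocked m M Q" and "u $ k < M"
  obtains v where "v \<in> closed_cube m M" "u \<le> v" "u $ k < v $ k" "\<And>i. i \<noteq> k \<Longrightarrow> v $ i = u $ i"
    "\<And>q. q \<in> Q \<Longrightarrow> q $ k < v $ k \<Longrightarrow> q $ k \<le> u $ k"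
proof -
  obtain y where y: "u $ k < y" "y \<le> M" "\<And>a. a \<in> (\<lambda>q. q $ k) ` Q \<Longrightarrow> a < y \<Longrightarrow> a \<le> u $ k"
    using finite_gap_above[of "(\<lambda>q. q $ k) ` Q" "u $ k" M] assms by blast
  let ?v = "replace_component k y u"
  have uM: "m \<le> u $ i" "u $ i \<le> M" for i using u by (auto simp: unblocked_def closed_cube_def)
  show ?thesis
  proof (rule that[of ?v])
    show "?v \<in> closed_cube m M"
      using uM y(1,2) order.trans[OF uM(1)[of k] less_imp_le[OF y(1)]]
      by (auto simp: closed_cube_def replace_component_def)
  qed (use y in \<open>auto simp: replace_component_def less_eq_vec_def\<close>)
qed

section \<open>Existence: the maximal unblocked points form an upper bound set\<close>

text \<open>Points of \<open>Q\<close> have all coordinates above \<open>m\<close>, so a coordinate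
  of \<open>u\<close> equal to \<open>m\<close> could be raised slightly without becoming
  blocked.\<close>

lemma maximal_unblocked_gt_lower:
  assumes "finite Q" "Q \<subseteq> open_cube m M" "m < M" and u: "u \<in> maximal_unblocked m M Q"
  shows "m < u $ k"
proof (rule ccontr)
  assume "\<not> m < u $ k"
  moreover have uF: "u \<in> unblocked m M Q" using u by (simp add: maximal_unblocked_def)
  ultimately have uk: "u $ k = m"
    by (auto simp: unblocked_def closed_cube_def intro!: antisym)
  then have "u $ k < M" using \<open>m < M\<close> by simp
  then obtain v where v: "v \<in> closed_cube m M" "u \<le> v" "u $ k < v $ k"
      "\<And>q. q \<in> Q \<Longrightarrow> q $ k < v $ k \<Longrightarrow> q $ k \<le> u $ k"
    using unblocked_raise_component[OF \<open>finite Q\<close> uF] by blast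
  have "\<not> strictly_below q v" if "q \<in> Q" for q
  proof
    assume "strictly_below q v"
    then have "q $ k \<le> m" using v(4)[OF that] uk by (simp add: strictly_below_def)
    moreover have "q \<in> open_cube m M" using that assms(2) by blast
    then have "m < q $ k" by (simp add: open_cube_def)
    ultimately show False by simp
  qed
  then have "v \<in> unblocked m M Q" using v by (simp add: unblocked_def)
  then show False using u v by (auto simp: maximal_unblocked_def)
qed

text \<open>Not being strictly above \<open>q\<close> is a union of closed half-spaces, one for each
  of the finitely many coordinates.\<close>

lemma closed_unblocked: "closed (unblocked m M Q)"
proof -
  have eq: "unblocked m M Q = (\<Inter>j. {u. m \<le> u $ j} \<inter> {u. u $ j \<le> M})
      \<inter> (\<Inter>q\<in>Q. \<Union>j. {u. u $ j \<le> q $ j})"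
    by (auto simp: unblocked_def closed_cube_def strictly_below_def not_less)
  show ?thesis unfolding eq
    by (intro closed_Int closed_INT closed_UN ballI finite_class.finite closed_Collect_le
        continuous_intros)
qed

text \<open>The coordinate sum attains its maximum on the compact set of unblocked points above
  \<open>u\<close>; as it is strictly increasing in the order, the maximizer is a maximal
  point.\<close>

lemma unblocked_le_maximal:
  fixes u :: "real ^ 'p"
  assumes u: "u \<in> unblocked m M Q"
  obtains w where "w \<in> maximal_unblocked m M Q" "u \<le> w"
proof -
  define K where "K = unblocked m M Q \<inter> {v. u \<le> v}"
  have "closed K"
  proof -
    have "K = unblocked m M Q \<inter> (\<Inter>j. {v. u $ j \<le> v $ j})"
      by (auto simp: K_def less_eq_vec_def)
    then show ?thesis
      by (auto intro!: closed_Int closed_unblocked closed_INT closed_Collect_le continuous_intros)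
  qed
  moreover have "bounded K"
  proof (rule bounded_subset[OF bounded_cbox])
    show "K \<subseteq> cbox (\<chi> i. m) (\<chi> i. M)"
      by (auto simp: K_def unblocked_def closed_cube_def mem_box_cart)
  qed
  ultimately have "compact K" by (simp add: compact_eq_bounded_closed)
  moreover have "K \<noteq> {}" using u by (auto simp: K_def)
  moreover have "continuous_on K (\<lambda>v. \<Sum>i\<in>UNIV. v $ i)" by (intro continuous_intros)
  ultimately obtain w where w: "w \<in> K" "\<And>v. v \<in> K \<Longrightarrow> (\<Sum>i\<in>UNIV. v $ i) \<le> (\<Sum>i\<in>UNIV. w $ i)"
    using continuous_attains_sup[of K "\<lambda>v. \<Sum>i\<in>UNIV. v $ i"] by blast
  have "v = w" if v: "v \<in> unblocked m M Q" "w \<le> v" for v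
  proof (rule ccontr)
    assume "v \<noteq> w"
    have le: "w $ i \<le> v $ i" for i using v by (simp add: less_eq_vec_def)
    obtain i where "w $ i \<noteq> v $ i" using \<open>v \<noteq> w\<close> by (metis vec_eq_iff)
    then have "(\<Sum>i\<in>UNIV. w $ i) < (\<Sum>i\<in>UNIV. v $ i)"
      using le by (intro sum_strict_mono_ex1) (auto intro!: exI[of _ i] simp: less_le)
    moreover have "v \<in> K" using v w(1) by (auto simp: K_def intro: order.trans)
    ultimately show False using w(2)[of v] by simp
  qed
  then show ?thesis using w(1) that[of w] by (auto simp: K_def maximal_unblocked_def)
qed

text \<open>Raise all coordinates of \<open>z\<close> by so little that any \<open>q\<close>
  strictly below the result already satisfies \<open>q \<le> z\<close>, which the search region
  forbids.\<close>

lemma search_region_below_unblocked: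
  fixes z :: "real ^ 'p"
  assumes "finite Q" and z: "z \<in> search_region m M Q"
  obtains u where "u \<in> unblocked m M Q" "strictly_below z u"
proof -
  have zM: "m < z $ i" "z $ i < M" for i using z by (auto simp: search_region_def open_cube_def)
  have "\<exists>y. z $ i < y \<and> y \<le> M \<and> (\<forall>q\<in>Q. q $ i < y \<longrightarrow> q $ i \<le> z $ i)" for i
    using finite_gap_above[of "(\<lambda>q. q $ i) ` Q" "z $ i" M] \<open>finite Q\<close> zM(2)[of i]
    by (metis finite_imageI imageI)
  then obtain y where y: "\<And>i. z $ i < y i" "\<And>i. y i \<le> M"
      "\<And>i q. q \<in> Q \<Longrightarrow> q $ i < y i \<Longrightarrow> q $ i \<le> z $ i" by metis
  let ?u = "\<chi> i. y i"
  have "\<not> strictly_below q ?u" if "q \<in> Q" for q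
    using z y(3)[OF that] that unfolding strictly_below_def search_region_def less_eq_vec_def by fastforce
  moreover have "?u \<in> closed_cube m M"
    using y(2) less_trans[OF zM(1) y(1)] by (auto simp: closed_cube_def intro: less_imp_le)
  ultimately show ?thesis
    using that[of ?u] y(1) by (auto simp: unblocked_def strictly_below_def)
qed

lemma is_upper_bound_set_maximal_unblocked:
  assumes "finite Q" "Q \<subseteq> open_cube m M" "m < M"
  shows "is_upper_bound_set m M Q (maximal_unblocked m M Q)"
  unfolding is_upper_bound_set_def
proof (intro conjI ballI equalityI subsetI)
  fix z assume "z \<in> search_region m M Q"
  then obtain u where u: "u \<in> unblocked m M Q" "strictly_below z u"
    using search_region_below_unblocked \<open>finite Q\<close> by blast
  obtain w where w: "w \<in> maximal_unblocked m M Q" "u \<le> w" using unblocked_le_maximal[OF u(1)] .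
  have "strictly_below z w"
    using u w unfolding strictly_below_def less_eq_vec_def by (auto intro: less_le_trans)
  then show "z \<in> (\<Union>u\<in>maximal_unblocked m M Q. search_zone m M u)"
    using w \<open>z \<in> search_region m M Q\<close> by (auto simp: search_zone_def search_region_def)
next
  fix u1 u2
  assume u: "u1 \<in> maximal_unblocked m M Q" "u2 \<in> maximal_unblocked m M Q"
  have cube: "u2 \<in> closed_cube m M" "u1 \<in> closed_cube m M"
    using u by (auto simp: maximal_unblocked_def unblocked_def)
  show "\<not> search_zone m M u1 \<subset> search_zone m M u2"
  proof
    assume sub: "search_zone m M u1 \<subset> search_zone m M u2"
    have "u1 \<le> u2"
    proof (rule ccontr)
      assume "\<not> u1 \<le> u2"
      then obtain i where i: "u2 $ i < u1 $ i" by (auto simp: less_eq_vec_def not_le)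
      \<comment> \<open>This point is strictly below \<open>u1\<close> but touches \<open>u2\<close>
        at coordinate \<open>i\<close>. It stays in the open cube because both bounds have all
        entries above \<open>m\<close>.\<close>
      define z where "z = (\<chi> k. if k = i then u2 $ i else (m + u1 $ k) / 2)"
      have "m < z $ k" "z $ k < u1 $ k" "u1 $ k \<le> M" for k
        using maximal_unblocked_gt_lower[OF assms u(1), of k]
          maximal_unblocked_gt_lower[OF assms u(2), of k] i cube
        by (auto simp: z_def closed_cube_def)
      then have "z \<in> search_zone m M u1"
        unfolding search_zone_def open_cube_def strictly_below_def by (auto intro: less_le_trans)
      moreover have "z \<notin> search_zone m M u2"
        unfolding search_zone_def strictly_below_def by (auto simp: z_def intro!: exI[of _ i])
      ultimately show False using sub by blast
    qed
    then have "u2 = u1" using u by (auto simp: maximal_unblocked_def)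
    then show False using sub by simp
  qed
next
  fix z assume "z \<in> (\<Union>u\<in>maximal_unblocked m M Q. search_zone m M u)"
  then show "z \<in> search_region m M Q"
    using search_zone_subset_region unfolding maximal_unblocked_def by blast
qed (auto simp: maximal_unblocked_def unblocked_def)

section \<open>Uniqueness of the upper bound set\<close>

text \<open>The join of \<open>u\<close> and \<open>v\<close> is still unblocked: a \<open>q\<close>
  strictly below it would be strictly below \<open>v\<close>, because \<open>q $ i < u $ i\<close>
  forces \<open>q $ i \<le> z $ i < v $ i\<close>. Maximality of \<open>u\<close> then makes the
  join equal to \<open>u\<close>. So a point close enough to \<open>u\<close> is covered only by
  zones of bounds below \<open>u\<close>.\<close>

lemma near_maximal_unblocked_le:
  fixes u :: "real ^ 'p"
  assumes u: "u \<in> maximal_unblocked m M Q" and v: "v \<in> unblocked m M Q" "strictly_below z v"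
    and near: "\<And>q i. q \<in> Q \<Longrightarrow> q $ i < u $ i \<Longrightarrow> q $ i \<le> z $ i"
  shows "v \<le> u"
proof -
  define w where "w = (\<chi> i. max (u $ i) (v $ i))"
  have "\<not> strictly_below q w" if "q \<in> Q" for q
  proof
    assume q: "strictly_below q w"
    have "q $ i < v $ i" for i
    proof (cases "q $ i < u $ i")
      case True
      then show ?thesis using near[OF that True] v(2) by (auto simp: strictly_below_def intro: le_less_trans)
    next
      case False
      then show ?thesis using q by (auto simp: strictly_below_def w_def less_max_iff_disj)
    qed
    then show False using v(1) that by (auto simp: unblocked_def strictly_below_def)
  qed
  moreover have "w \<in> closed_cube m M"
    using u v by (auto simp: maximal_unblocked_def unblocked_def closed_cube_def w_def le_max_iff_disj)
  ultimately have "w \<in> unblocked m M Q" by (simp add: unblocked_def)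
  moreover have "u \<le> w" by (simp add: w_def less_eq_vec_def)
  ultimately have "w = u" using u by (auto simp: maximal_unblocked_def)
  then show ?thesis by (metis less_eq_vec_def max.cobounded2 vec_lambda_beta w_def)
qed

text \<open>
  A priori \<open>U\<close> may be infinite, so its members could approach a maximal \<open>u\<close> without reaching it.
  This is excluded by choosing, for each set \<open>A\<close> of coordinates, one member \<open>r A\<close> that agrees with
  \<open>u\<close> exactly on \<open>A\<close>, and then covering a point \<open>z\<close> that is closer to \<open>u\<close> than all of these.
\<close>

lemma maximal_unblocked_subset:
  fixes Q :: "(real ^ 'p) set"
  assumes fin: "finite Q" and Q: "Q \<subseteq> open_cube m M" and "m < M"
    and U: "is_upper_bound_set m M Q U"
  shows "maximal_unblocked m M Q \<subseteq> U"
proof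
  fix u assume u: "u \<in> maximal_unblocked m M Q"
  define D where "D A v \<longleftrightarrow> v \<in> U \<and> v \<le> u \<and> {i. v $ i = u $ i} = A" for A v
  \<comment> \<open>There are finitely many coordinate sets \<open>A\<close>, so
    \<open>range r\<close> is finite even if \<open>U\<close> is not, and
    \<open>finite_gap_below\<close> applies. Where no \<open>v\<close> satisfies
    \<open>D A v\<close>, \<open>r A\<close> is arbitrary and merely adds a harmless value to the
    gap condition.\<close>
  define r where "r A = (SOME v. D A v)" for A
  have r: "D A (r A)" if "D A v" for A v
    unfolding r_def using that by (rule someI)
  have "\<exists>y>m. y < u $ i \<and> (\<forall>q\<in>Q \<union> range r. q $ i < u $ i \<longrightarrow> q $ i \<le> y)" for i
    using finite_gap_below[of "(\<lambda>q. q $ i) ` (Q \<union> range r)" m "u $ i"] fin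
      maximal_unblocked_gt_lower[OF fin Q \<open>m < M\<close> u, of i]
    by (metis finite_UnI finite_class.finite finite_imageI imageI)
  then obtain y where y: "\<And>i. m < y i" "\<And>i. y i < u $ i"
      "\<And>i q. q \<in> Q \<union> range r \<Longrightarrow> q $ i < u $ i \<Longrightarrow> q $ i \<le> y i" by metis
  define z where "z = (\<chi> i. y i)"
  have uF: "u \<in> unblocked m M Q" using u by (simp add: maximal_unblocked_def)
  then have "u $ i \<le> M" for i by (auto simp: unblocked_def closed_cube_def)
  then have "z \<in> search_zone m M u"
    using y(1) y(2) unfolding search_zone_def open_cube_def strictly_below_def z_def
    by (auto intro: less_le_trans)
  then have "z \<in> search_region m M Q" using search_zone_subset_region[OF uF] by blast
  then obtain v where v: "v \<in> U" "z \<in> search_zone m M v"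
    using U by (auto simp: is_upper_bound_set_def)
  then have zv: "strictly_below z v" by (simp add: search_zone_def)
  have vcube: "v \<in> closed_cube m M" using U v(1) by (auto simp: is_upper_bound_set_def)
  moreover have "search_zone m M v \<subseteq> search_region m M Q"
    using U v(1) by (auto simp: is_upper_bound_set_def)
  ultimately have "v \<in> unblocked m M Q" using unblocked_if_zone_subset_region[OF Q] by blast
  then have "v \<le> u"
    using y(3) by (intro near_maximal_unblocked_le[OF u _ zv]) (auto simp: z_def)
  define A where "A = {i. v $ i = u $ i}"
  have "D A v" using v \<open>v \<le> u\<close> by (simp add: D_def A_def)
  then have rA: "r A \<in> U" "r A \<le> u" "{i. r A $ i = u $ i} = A"
    using r[of A v] by (simp_all add: D_def)
  have lt: "r A $ i < v $ i" if "i \<notin> A" for i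
  proof -
    have "r A $ i < u $ i" using that rA by (force simp: less_eq_vec_def less_le)
    then have "r A $ i \<le> y i" by (intro y(3)) auto
    also have "y i < v $ i" using zv by (simp add: strictly_below_def z_def)
    finally show ?thesis .
  qed
  have eq: "r A $ i = v $ i" if "i \<in> A" for i
    using that rA(3) by (auto simp: A_def)
  \<comment> \<open>Both \<open>r A\<close> and \<open>v\<close> belong to \<open>U\<close>, so
    being comparable forces equality. Then \<open>lt\<close> leaves no coordinate outside
    \<open>A\<close>, which means \<open>v = u\<close>.\<close>
  have "r A \<le> v" using lt eq by (metis less_eq_vec_def less_imp_le order_refl)
  moreover have "m < v $ i" for i
    using y(1)[of i] zv by (auto simp: strictly_below_def z_def intro: less_trans)
  ultimately have "r A = v"
    using search_zone_psubset[OF vcube, of "r A"] U v(1) rA(1)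
    by (auto simp: is_upper_bound_set_def)
  then have "A = UNIV" using lt by auto
  then have "v = u" by (auto simp: A_def vec_eq_iff)
  then show "u \<in> U" using v by simp
qed

text \<open>For the remaining inclusion, a member of \<open>U\<close> lies below a maximal point,
  which is itself in \<open>U\<close>; if they differed, their zones would be properly
  nested.\<close>

lemma upper_bound_set_eq_maximal_unblocked:
  assumes fin: "finite Q" and Q: "Q \<subseteq> open_cube m M" and "m < M"
  shows "upper_bound_set m M Q = maximal_unblocked m M Q"
  unfolding upper_bound_set_def
proof (rule the_equality)
  show "is_upper_bound_set m M Q (maximal_unblocked m M Q)"
    using is_upper_bound_set_maximal_unblocked assms .
  fix U assume U: "is_upper_bound_set m M Q U"
  have sub: "maximal_unblocked m M Q \<subseteq> U" using maximal_unblocked_subset assms U .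
  have "u \<in> maximal_unblocked m M Q" if "u \<in> U" for u
  proof -
    have "u \<in> unblocked m M Q"
      using U that by (intro unblocked_if_zone_subset_region[OF Q]) (auto simp: is_upper_bound_set_def)
    then obtain w where w: "w \<in> maximal_unblocked m M Q" "u \<le> w" using unblocked_le_maximal by blast
    then have "w \<in> closed_cube m M" by (simp add: maximal_unblocked_def unblocked_def)
    then have "search_zone m M u \<subset> search_zone m M w" if "u \<noteq> w"
      using search_zone_psubset maximal_unblocked_gt_lower[OF assms w(1)] w(2) that by blast
    moreover have "\<not> search_zone m M u \<subset> search_zone m M w"
      using U w(1) sub that unfolding is_upper_bound_set_def by blast
    ultimately have "u = w" by blast
    then show ?thesis using w by simp
  qed
  then show "U = maximal_unblocked m M Q" using sub by blast
qed

section \<open>Maximality expressed by defining points\<close>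

text \<open>If \<open>u $ k < M\<close>, a slight raise of coordinate \<open>k\<close> must fail,
  and the point of \<open>Q\<close> stopping it is a defining point; if \<open>u $ k = M\<close>, a
  dummy point serves. Conversely, if \<open>v\<close> exceeds \<open>u\<close> at \<open>k\<close>,
  a defining point for \<open>k\<close> is strictly below \<open>v\<close>. It is then not in
  \<open>Q\<close>, nor a dummy, whose entry \<open>M\<close> cannot be exceeded.\<close>

lemma maximal_unblocked_iff_defining_points:
  fixes u :: "real ^ 'p"
  assumes fin: "finite Q" and Q: "Q \<subseteq> open_cube m M" and "m < M" and u: "u \<in> unblocked m M Q"
  shows "u \<in> maximal_unblocked m M Q \<longleftrightarrow> (\<forall>k. defining_points m M Q k u \<noteq> {})"
proof
  assume max: "u \<in> maximal_unblocked m M Q"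
  note gt = maximal_unblocked_gt_lower[OF fin Q \<open>m < M\<close> max]
  show "\<forall>k. defining_points m M Q k u \<noteq> {}"
  proof
    fix k
    show "defining_points m M Q k u \<noteq> {}"
    proof (cases "u $ k < M")
      case False
      then have "u $ k = M" using u by (auto simp: unblocked_def closed_cube_def intro!: antisym)
      then have "dummy_point m M k \<in> defining_points m M Q k u"
        using gt by (auto simp: defining_points_def augmented_def dummy_point_def)
      then show ?thesis by blast
    next
      case True
      then obtain v where v: "v \<in> closed_cube m M" "u \<le> v" "u $ k < v $ k"
          "\<And>i. i \<noteq> k \<Longrightarrow> v $ i = u $ i" "\<And>q. q \<in> Q \<Longrightarrow> q $ k < v $ k \<Longrightarrow> q $ k \<le> u $ k"
        using unblocked_raise_component[OF fin u] by blast
      then have "v \<notin> unblocked m M Q" using max by (auto simp: maximal_unblocked_def)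
      then obtain q where q: "q \<in> Q" "strictly_below q v" using v(1) by (auto simp: unblocked_def)
      have below: "q $ i < u $ i" if "i \<noteq> k" for i
        using q(2) v(4)[OF that] by (metis strictly_below_def)
      have "q $ k \<le> u $ k" using q v(5) by (auto simp: strictly_below_def)
      moreover have "\<not> q $ k < u $ k"
      proof
        assume "q $ k < u $ k"
        with below have "strictly_below q u" unfolding strictly_below_def by metis
        then show False using q(1) u by (simp add: unblocked_def)
      qed
      ultimately have "q \<in> defining_points m M Q k u"
        using q below by (auto simp: defining_points_def augmented_def)
      then show ?thesis by blast
    qed
  qed
next
  assume def: "\<forall>k. defining_points m M Q k u \<noteq> {}"
  have "v = u" if v: "v \<in> unblocked m M Q" "u \<le> v" for v
  proof (rule ccontr)
    assume "v \<noteq> u"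
    have le: "u $ i \<le> v $ i" "v $ i \<le> M" for i
      using v by (auto simp: less_eq_vec_def unblocked_def closed_cube_def)
    obtain k where "v $ k \<noteq> u $ k" using \<open>v \<noteq> u\<close> by (auto simp: vec_eq_iff)
    then have k: "u $ k < v $ k" using le(1)[of k] by simp
    obtain z where z: "z \<in> augmented m M Q" "z $ k = u $ k" "\<And>i. i \<noteq> k \<Longrightarrow> z $ i < u $ i"
      using spec[OF def, of k] by (auto simp: defining_points_def)
    have zv: "z $ i < v $ i" for i
      using z(2) z(3)[of i] k le(1)[of i] by (cases "i = k") auto
    then have "z \<notin> Q" using v by (auto simp: unblocked_def strictly_below_def)
    then obtain j where "z = dummy_point m M j" using z(1) by (auto simp: augmented_def)
    then show False using zv[of j] le(2)[of j] by (simp add: dummy_point_def)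
  qed
  then show "u \<in> maximal_unblocked m M Q" using u by (auto simp: maximal_unblocked_def)
qed

section \<open>Replacing one coordinate of a bound\<close>

theorem theorem2:
  fixes m M :: real
    and N :: "(real ^ 'p) set"
    and zb u :: "real ^ 'p"
  assumes "CARD('p) \<ge> 2"
    and "m < M"
    and "N \<subseteq> open_cube m M"
    and "finite N"
    and "stable_set N"
    and "zb \<in> open_cube m M"
    and "\<forall>z\<in>N. \<not> dominates z zb"
    and "u \<in> upper_bound_set m M N"
    and "strictly_below zb u"
  shows "\<forall>j. replace_component j (zb $ j) u \<in> upper_bound_set m M (N \<union> {zb})
              \<longleftrightarrow> zb $ j > z_max m M N j u"
proof
  fix j
  let ?Q = "N \<union> {zb}"
  define v where "v = replace_component j (zb $ j) u"
  have v: "v $ i = (if i = j then zb $ j else u $ i)" for i by (simp add: v_def replace_component_def)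
  have zbu: "zb $ i < u $ i" for i using assms(9) by (simp add: strictly_below_def)
  have Q: "finite ?Q" "?Q \<subseteq> open_cube m M" using assms by auto
  have u: "u \<in> maximal_unblocked m M N"
    using assms upper_bound_set_eq_maximal_unblocked[of N m M] by simp
  then have uF: "u \<in> unblocked m M N" by (simp add: maximal_unblocked_def)
  have ne: "defining_points m M N k u \<noteq> {}" for k
    using maximal_unblocked_iff_defining_points[OF assms(4,3,2) uF] u by blast
  have fin: "finite (defining_points m M N k u)" for k
    using assms(4) by (simp add: defining_points_def augmented_def)
  have vF: "v \<in> unblocked m M ?Q"
  proof -
    have "v \<in> closed_cube m M"
      using uF assms(6) by (auto simp: unblocked_def closed_cube_def open_cube_def v less_imp_le)
    moreover have "\<not> strictly_below zb v"
      by (auto simp: strictly_below_def v intro!: exI[of _ j])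
    moreover have "\<not> strictly_below q v" if "q \<in> N" for q
    proof
      assume q: "strictly_below q v"
      have "q $ i < u $ i" for i
        using q zbu[of i] by (auto simp: strictly_below_def v dest!: spec[of _ i] split: if_splits)
      then show False using uF that by (auto simp: unblocked_def strictly_below_def)
    qed
    ultimately show ?thesis by (auto simp: unblocked_def)
  qed
  have self: "zb \<in> defining_points m M ?Q j v"
    using zbu by (simp add: defining_points_def augmented_def v)
  \<comment> \<open>The new point \<open>zb\<close> cannot define coordinate \<open>k\<close>, since
    \<open>zb $ k < u $ k\<close>. On old points only the condition at \<open>j\<close> changes,
    from \<open>z $ j < u $ j\<close> to the stronger \<open>z $ j < zb $ j\<close>.\<close>
  have other: "defining_points m M ?Q k v = {z \<in> defining_points m M N k u. z $ j < zb $ j}"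
    if "k \<noteq> j" for k
  proof (intro equalityI subsetI)
    fix z assume z: "z \<in> defining_points m M ?Q k v"
    then have zk: "z $ k = u $ k" and zi: "\<And>i. i \<noteq> k \<Longrightarrow> z $ i < v $ i"
      using that by (auto simp: defining_points_def v)
    have "z \<noteq> zb" using zk zbu[of k] by auto
    then have "z \<in> augmented m M N" using z by (auto simp: defining_points_def augmented_def)
    moreover have "z $ i < u $ i" if "i \<noteq> k" for i
      using zi[OF that] zbu[of i] by (auto simp: v split: if_splits)
    moreover have "z $ j < zb $ j" using zi[of j] that by (simp add: v)
    ultimately show "z \<in> {z \<in> defining_points m M N k u. z $ j < zb $ j}"
      using zk by (simp add: defining_points_def)
  next
    fix z assume "z \<in> {z \<in> defining_points m M N k u. z $ j < zb $ j}"
    then show "z \<in> defining_points m M ?Q k v"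
      using that by (auto simp: defining_points_def augmented_def v)
  qed
  \<comment> \<open>Dimension at least 2 makes the outer maximum range over a nonempty set, so its
    comparison with \<open>zb $ j\<close> splits into one condition per \<open>k\<close>.\<close>
  have "UNIV - {j} \<noteq> {}"
  proof
    assume "UNIV - {j} = {}"
    then have "(UNIV :: 'p set) = {j}" by blast
    then have "CARD('p) = 1" by (metis card_1_singleton_iff One_nat_def)
    then show False using assms(1) by simp
  qed
  then have "z_max m M N j u < zb $ j
      \<longleftrightarrow> (\<forall>k\<in>UNIV - {j}. (MIN z\<in>defining_points m M N k u. z $ j) < zb $ j)"
    unfolding z_max_def by (subst Max_less_iff) auto
  \<comment> \<open>A minimum over a finite nonempty set is below \<open>zb $ j\<close> iff some
    element is; by \<open>other\<close> such elements are the defining points of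
    \<open>v\<close>.\<close>
  also have "\<dots> \<longleftrightarrow> (\<forall>k\<in>UNIV - {j}. defining_points m M ?Q k v \<noteq> {})"
    using fin ne other by (auto simp: Min_less_iff)
  also have "\<dots> \<longleftrightarrow> (\<forall>k. defining_points m M ?Q k v \<noteq> {})"
    using self by blast
  also have "\<dots> \<longleftrightarrow> v \<in> maximal_unblocked m M ?Q"
    using maximal_unblocked_iff_defining_points[OF Q assms(2) vF] by simp
  also have "\<dots> \<longleftrightarrow> v \<in> upper_bound_set m M ?Q"
    using upper_bound_set_eq_maximal_unblocked[OF Q assms(2)] by simp
  finally show "replace_component j (zb $ j) u \<in> upper_bound_set m M ?Q
      \<longleftrightarrow> zb $ j > z_max m M N j u"
    by (simp add: v_def)
qed

end
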